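(* Let $\mathcal{R}$ be an associative ring with unit $1\neq 0$, let $a,x\in\mathcal{R}$, let $\mathcal{S},\mathcal{T}$ be right ideals of $\mathcal{R}$ and let $\mathcal{S}',\mathcal{T}'$ be left ideals of $\mathcal{R}$. Then: (1) $x=a^{(2)}_{{\rm rprin}=\mathcal{S},{\rm lprin}=\mathcal{S}'}\Leftrightarrow x\in Y_{a,\mathcal{S},\mathcal{S}'}\cap Z_{a,\mathcal{S},\mathcal{S}'}\Leftrightarrow x=\max_{\mathcal{M}}Y_{a,\mathcal{S},\mathcal{S}'}=\min_{\mathcal{M}}Z_{a,\mathcal{S},\mathcal{S}'}$. (2) $x=a^{(2)}_{{\rm rprin}=\mathcal{S},{\rm rann}=\mathcal{T}}\Leftrightarrow x\in Y_{a,\mathcal{S},\mathcal{T}}\cap Z_{a,\mathcal{S},\mathcal{T}}\Leftrightarrow x=\max_{\mathcal{M}}Y_{a,\mathcal{S},\mathcal{T}}=\min_{\mathcal{M}}Z_{a,\mathcal{S},\mathcal{T}}$. (3) $x=a^{(2)}_{{\rm lprin}=\mathcal{S}',{\rm lann}=\mathcal{T}'}\Leftrightarrow x\in Y_{a,\mathcal{S}',\mathcal{T}'}\cap Z_{a,\mathcal{S}',\mathcal{T}'}\Leftrightarrow x=\max_{\mathcal{M}}Y_{a,\mathcal{S}',\mathcal{T}'}=\min_{\mathcal{M}}Z_{a,\mathcal{S}',\mathcal{T}'}$. (4) $x=a^{(2)}_{{\rm rann}=\mathcal{T},{\rm lann}=\mathcal{T}'}\Leftrightarrow x\in Y_{a,\mathcal{T},\mathcal{T}'}\cap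 Z_{a,\mathcal{T},\mathcal{T}'}\Leftrightarrow x=\max_{\mathcal{M}}Y_{a,\mathcal{T},\mathcal{T}'}=\min_{\mathcal{M}}Z_{a,\mathcal{T},\mathcal{T}'}$.
   Context: Notation: $a\{2\}=\{x\in\mathcal{R}:xax=x\}$; $a\mathcal{R}=\{ar:r\in\mathcal{R}\}$, $\mathcal{R}a=\{ra:r\in\mathcal{R}\}$, ${\rm rann}(a)=\{r\in\mathcal{R}:ar=0\}$, ${\rm lann}(a)=\{r\in\mathcal{R}:ra=0\}$. The symbols $a^{(2)}_{\ldots}$ denote the (unique, if it exists) $x\in a\{2\}$ satisfying the prescribed conditions, where ${\rm rprin}=\mathcal{S}$ means $x\mathcal{R}=\mathcal{S}$, ${\rm lprin}=\mathcal{S}'$ means $\mathcal{R}x=\mathcal{S}'$, ${\rm rann}=\mathcal{T}$ means ${\rm rann}(x)=\mathcal{T}$, ${\rm lann}=\mathcal{T}'$ means ${\rm lann}(x)=\mathcal{T}'$. The Mitsch partial order $\mathcal{M}$ on $\mathcal{R}$: $y\mathcal{M}z$ if there exist $v,w\in\mathcal{R}$ such that $vz=vy=y=yw=zw$. For $Y\subseteq\mathcal{R}$, $\max_{\mathcal{M}}Y$ (resp. $\min_{\mathcal{M}}Y$) is the greatest (resp. least) element of $Y$ with respect to $\mathcal{M}$; i.e. an element $x\in Y$ with $y\mathcal{M}x$ (resp. $x\mathcal{M}y$) for all $y\in Y$. The sets are: $Y_{a,\mathcal{S},\mathcal{S}'}=\{y\in a\{2\}: y\in\mathcal{S}\cap\mathcal{S}'\}$,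 $Z_{a,\mathcal{S},\mathcal{S}'}=\{z\in a\{2\}:\mathcal{S}\subseteq z\mathcal{R},\ \mathcal{S}'\subseteq\mathcal{R}z\}$; $Y_{a,\mathcal{S},\mathcal{T}}=\{y\in a\{2\}: y\in\mathcal{S},\ \mathcal{T}\subseteq{\rm rann}(y)\}$, $Z_{a,\mathcal{S},\mathcal{T}}=\{z\in a\{2\}:\mathcal{S}\subseteq z\mathcal{R},\ {\rm rann}(z)\subseteq\mathcal{T}\}$; $Y_{a,\mathcal{S}',\mathcal{T}'}=\{y\in a\{2\}: y\in\mathcal{S}',\ \mathcal{T}'\subseteq{\rm lann}(y)\}$, $Z_{a,\mathcal{S}',\mathcal{T}'}=\{z\in a\{2\}:\mathcal{S}'\subseteq\mathcal{R}z,\ {\rm lann}(z)\subseteq\mathcal{T}'\}$; $Y_{a,\mathcal{T},\mathcal{T}'}=\{y\in a\{2\}:\mathcal{T}\subseteq{\rm rann}(y),\ \mathcal{T}'\subseteq{\rm lann}(y)\}$, $Z_{a,\mathcal{T},\mathcal{T}'}=\{z\in a\{2\}:{\rm rann}(z)\subseteq\mathcal{T},\ {\rm lann}(z)\subseteq\mathcal{T}'\}$. *)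

theory Defs
  imports Main
begin

text \<open>
  The ring is a type of class \<open>ring_1\<close>: associative, unital, not necessarily commutative, and
  with \<open>1 \<noteq> 0\<close> (the class includes \<open>zero_neq_one\<close>).
\<close>

definition right_ideal :: "'a::ring_1 set \<Rightarrow> bool" where
  "right_ideal I \<longleftrightarrow>
     0 \<in> I \<and> (\<forall>u\<in>I. \<forall>v\<in>I. u + v \<in> I) \<and> (\<forall>u\<in>I. - u \<in> I) \<and> (\<forall>u\<in>I. \<forall>r. u * r \<in> I)"

definition left_ideal :: "'a::ring_1 set \<Rightarrow> bool" where
  "left_ideal I \<longleftrightarrow>
     0 \<in> I \<and> (\<forall>u\<in>I. \<forall>v\<in>I. u + v \<in> I) \<and> (\<forall>u\<in>I. - u \<in> I) \<and> (\<forall>u\<in>I. \<forall>r. r * u \<in> I)"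

definition outer_inverses :: "'a::ring_1 \<Rightarrow> 'a set" where
  "outer_inverses a = {x. x * a * x = x}"

definition rprin :: "'a::ring_1 \<Rightarrow> 'a set" where
  "rprin a = {a * r | r. True}"

definition lprin :: "'a::ring_1 \<Rightarrow> 'a set" where
  "lprin a = {r * a | r. True}"

definition rann :: "'a::ring_1 \<Rightarrow> 'a set" where
  "rann a = {r. a * r = 0}"

definition lann :: "'a::ring_1 \<Rightarrow> 'a set" where
  "lann a = {r. r * a = 0}"

text \<open>
  \<open>is_outer_inverse_with a P x\<close> renders \<open>x = a\<^sup>(\<^sup>2\<^sup>)\<close> with the prescribed conditions \<open>P\<close>: the element
  exists, is unique, and equals \<open>x\<close>. It is a relation and not a definite description, so that the
  equation is false whenever the outer inverse does not exist.
\<close>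

definition is_outer_inverse_with :: "'a::ring_1 \<Rightarrow> ('a \<Rightarrow> bool) \<Rightarrow> 'a \<Rightarrow> bool" where
  "is_outer_inverse_with a P x \<longleftrightarrow>
     x \<in> outer_inverses a \<and> P x \<and> (\<forall>y \<in> outer_inverses a. P y \<longrightarrow> y = x)"

definition is_outer_inverse_rprin_lprin :: "'a::ring_1 \<Rightarrow> 'a set \<Rightarrow> 'a set \<Rightarrow> 'a \<Rightarrow> bool" where
  "is_outer_inverse_rprin_lprin a S S' =
     is_outer_inverse_with a (\<lambda>x. rprin x = S \<and> lprin x = S')"

definition is_outer_inverse_rprin_rann :: "'a::ring_1 \<Rightarrow> 'a set \<Rightarrow> 'a set \<Rightarrow> 'a \<Rightarrow> bool" where
  "is_outer_inverse_rprin_rann a S T =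
     is_outer_inverse_with a (\<lambda>x. rprin x = S \<and> rann x = T)"

definition is_outer_inverse_lprin_lann :: "'a::ring_1 \<Rightarrow> 'a set \<Rightarrow> 'a set \<Rightarrow> 'a \<Rightarrow> bool" where
  "is_outer_inverse_lprin_lann a S' T' =
     is_outer_inverse_with a (\<lambda>x. lprin x = S' \<and> lann x = T')"

definition is_outer_inverse_rann_lann :: "'a::ring_1 \<Rightarrow> 'a set \<Rightarrow> 'a set \<Rightarrow> 'a \<Rightarrow> bool" where
  "is_outer_inverse_rann_lann a T T' =
     is_outer_inverse_with a (\<lambda>x. rann x = T \<and> lann x = T')"

definition mitsch_le :: "'a::ring_1 \<Rightarrow> 'a \<Rightarrow> bool" where
  "mitsch_le y z \<longleftrightarrow> (\<exists>v w. v * z = v * y \<and> v * y = y \<and> y = y * w \<and> y * w = z * w)"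

text \<open>Greatest and least elements, not merely maximal and minimal ones.\<close>

definition is_mitsch_max :: "'a::ring_1 set \<Rightarrow> 'a \<Rightarrow> bool" where
  "is_mitsch_max A x \<longleftrightarrow> x \<in> A \<and> (\<forall>y\<in>A. mitsch_le y x)"

definition is_mitsch_min :: "'a::ring_1 set \<Rightarrow> 'a \<Rightarrow> bool" where
  "is_mitsch_min A x \<longleftrightarrow> x \<in> A \<and> (\<forall>y\<in>A. mitsch_le x y)"

definition Y_rprin_lprin :: "'a::ring_1 \<Rightarrow> 'a set \<Rightarrow> 'a set \<Rightarrow> 'a set" where
  "Y_rprin_lprin a S S' = {y \<in> outer_inverses a. y \<in> S \<inter> S'}"

definition Z_rprin_lprin :: "'a::ring_1 \<Rightarrow> 'a set \<Rightarrow> 'a set \<Rightarrow> 'a set" where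
  "Z_rprin_lprin a S S' = {z \<in> outer_inverses a. S \<subseteq> rprin z \<and> S' \<subseteq> lprin z}"

definition Y_rprin_rann :: "'a::ring_1 \<Rightarrow> 'a set \<Rightarrow> 'a set \<Rightarrow> 'a set" where
  "Y_rprin_rann a S T = {y \<in> outer_inverses a. y \<in> S \<and> T \<subseteq> rann y}"

definition Z_rprin_rann :: "'a::ring_1 \<Rightarrow> 'a set \<Rightarrow> 'a set \<Rightarrow> 'a set" where
  "Z_rprin_rann a S T = {z \<in> outer_inverses a. S \<subseteq> rprin z \<and> rann z \<subseteq> T}"

definition Y_lprin_lann :: "'a::ring_1 \<Rightarrow> 'a set \<Rightarrow> 'a set \<Rightarrow> 'a set" where
  "Y_lprin_lann a S' T' = {y \<in> outer_inverses a. y \<in> S' \<and> T' \<subseteq> lann y}"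

definition Z_lprin_lann :: "'a::ring_1 \<Rightarrow> 'a set \<Rightarrow> 'a set \<Rightarrow> 'a set" where
  "Z_lprin_lann a S' T' = {z \<in> outer_inverses a. S' \<subseteq> lprin z \<and> lann z \<subseteq> T'}"

definition Y_rann_lann :: "'a::ring_1 \<Rightarrow> 'a set \<Rightarrow> 'a set \<Rightarrow> 'a set" where
  "Y_rann_lann a T T' = {y \<in> outer_inverses a. T \<subseteq> rann y \<and> T' \<subseteq> lann y}"

definition Z_rann_lann :: "'a::ring_1 \<Rightarrow> 'a set \<Rightarrow> 'a set \<Rightarrow> 'a set" where
  "Z_rann_lann a T T' = {z \<in> outer_inverses a. rann z \<subseteq> T \<and> lann z \<subseteq> T'}"

end

theory Submission
  imports Defs
begin

text \<open>
  An outer inverse \<open>z\<close> of \<open>a\<close> gives two idempotents: \<open>z * a\<close> projects onto \<open>z\<R>\<close> and has left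
  annihilator \<open>lann z\<close>, and \<open>a * z\<close> projects onto \<open>\<R>z\<close> and has right annihilator \<open>rann z\<close>. Hence,
  for a second element \<open>y\<close>, both \<open>y \<in> z\<R>\<close> and \<open>lann z \<subseteq> lann y\<close> make \<open>z * a\<close> fix \<open>y\<close> on the left,
  and both \<open>y \<in> \<R>z\<close> and \<open>rann z \<subseteq> rann y\<close> make \<open>a * z\<close> fix \<open>y\<close> on the right. If \<open>y\<close> is an outer
  inverse too, the two fixing equations together put \<open>y\<close> below \<open>z\<close> in the Mitsch order, with
  witnesses \<open>y * a\<close> and \<open>a * y\<close> (lemma \<open>mitsch_leI_outer\<close>).

  In each of the four parts the prescribed data bound every member of \<open>Y\<close> from above by every
  member of \<open>Z\<close>, one side of the multiplication at a time. An element of \<open>Y \<inter> Z\<close> is therefore the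
  greatest element of \<open>Y\<close> and the least element of \<open>Z\<close>, and by antisymmetry there is at most one.
  Such an element is the required outer inverse, because \<open>Y\<close> and \<open>Z\<close> contribute opposite inclusions
  to each prescribed equation; here \<open>x \<in> S\<close> counts as \<open>x\<R> \<subseteq> S\<close> because \<open>S\<close> is a right ideal, and
  dually for \<open>S'\<close>. Lemma \<open>outer_inverse_sandwich\<close> carries out this order
  argument once for all four parts.
\<close>

lemma mitsch_le_antisym:
  assumes "mitsch_le y z" and "mitsch_le z y"
  shows "y = z"
proof -
  obtain w where w: "y * w = y" "z * w = y"
    using assms(1) unfolding mitsch_le_def by metis
  obtain v where v: "v * y = z"
    using assms(2) unfolding mitsch_le_def by metis
  have "z * w = v * (y * w)"
    by (simp add: v[symmetric] mult.assoc)
  then show ?thesis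
    using w v by simp
qed

lemma mitsch_leI_outer:
  assumes "y \<in> outer_inverses a" and "z * a * y = y" and "y * a * z = y"
  shows "mitsch_le y z"
proof -
  have "(y * a) * z = (y * a) * y \<and> (y * a) * y = y \<and> y = y * (a * y) \<and> y * (a * y) = z * (a * y)"
    using assms by (simp add: outer_inverses_def mult.assoc)
  then show ?thesis
    unfolding mitsch_le_def by blast
qed

lemma left_fixed_if_mem_rprin:
  assumes "z \<in> outer_inverses a" and "y \<in> rprin z"
  shows "z * a * y = y"
proof -
  obtain r where "y = z * r"
    using assms(2) by (auto simp: rprin_def)
  then show ?thesis
    using assms(1) by (simp add: outer_inverses_def mult.assoc[symmetric])
qed

lemma right_fixed_if_mem_lprin:
  assumes "z \<in> outer_inverses a" and "y \<in> lprin z"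
  shows "y * a * z = y"
proof -
  obtain r where "y = r * z"
    using assms(2) by (auto simp: lprin_def)
  then show ?thesis
    using assms(1) by (simp add: outer_inverses_def mult.assoc)
qed

text \<open>The complementary idempotent \<open>1 - z * a\<close> annihilates \<open>z\<close> from the left, hence \<open>y\<close> as well.\<close>

lemma left_fixed_if_lann_subset:
  assumes "z \<in> outer_inverses a" and "lann z \<subseteq> lann y"
  shows "z * a * y = y"
proof -
  have "1 - z * a \<in> lann z"
    using assms(1) by (simp add: outer_inverses_def lann_def left_diff_distrib)
  then have "1 - z * a \<in> lann y"
    using assms(2) by blast
  then show ?thesis
    by (simp add: lann_def left_diff_distrib)
qed

lemma right_fixed_if_rann_subset:
  assumes "z \<in> outer_inverses a" and "rann z \<subseteq> rann y"
  shows "y * a * z = y"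
proof -
  have "1 - a * z \<in> rann z"
    using assms(1) by (simp add: outer_inverses_def rann_def right_diff_distrib mult.assoc)
  then have "1 - a * z \<in> rann y"
    using assms(2) by blast
  then show ?thesis
    by (simp add: rann_def right_diff_distrib mult.assoc)
qed

lemma rprin_subset_right_ideal_iff:
  assumes "right_ideal S"
  shows "rprin x \<subseteq> S \<longleftrightarrow> x \<in> S"
proof
  assume "rprin x \<subseteq> S"
  moreover have "x * 1 \<in> rprin x"
    unfolding rprin_def by blast
  ultimately show "x \<in> S"
    by auto
next
  assume "x \<in> S"
  then show "rprin x \<subseteq> S"
    using assms by (auto simp: rprin_def right_ideal_def)
qed

lemma lprin_subset_left_ideal_iff:
  assumes "left_ideal S"
  shows "lprin x \<subseteq> S \<longleftrightarrow> x \<in> S"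
proof
  assume "lprin x \<subseteq> S"
  moreover have "1 * x \<in> lprin x"
    unfolding lprin_def by blast
  ultimately show "x \<in> S"
    by auto
next
  assume "x \<in> S"
  then show "lprin x \<subseteq> S"
    using assms by (auto simp: lprin_def left_ideal_def)
qed

text \<open>
  The order-theoretic core. \<open>L\<close> is the half of the prescribed condition \<open>P\<close> that bounds an outer
  inverse from above, and \<open>U\<close> is the half that bounds it from below. The only interaction required
  between them is that \<open>L\<close>-elements lie below \<open>U\<close>-elements; in particular two elements with both
  properties lie below each other, which makes the prescribed outer inverse unique.
\<close>

lemma outer_inverse_sandwich:
  fixes a x :: "'a::ring_1"
  assumes P: "\<And>z. P z \<longleftrightarrow> L z \<and> U z"
    and le: "\<And>y z. \<lbrakk>y \<in> outer_inverses a; z \<in> outer_inverses a; L y; U z\<rbrakk> \<Longrightarrow> mitsch_le y z"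
  defines "Y \<equiv> {y \<in> outer_inverses a. L y}" and "Z \<equiv> {z \<in> outer_inverses a. U z}"
  shows "(is_outer_inverse_with a P x \<longleftrightarrow> x \<in> Y \<inter> Z) \<and>
    (x \<in> Y \<inter> Z \<longleftrightarrow> is_mitsch_max Y x \<and> is_mitsch_min Z x)"
proof
  have "y = x" if "x \<in> Y \<inter> Z" and "y \<in> Y \<inter> Z" for y
    using that le mitsch_le_antisym unfolding Y_def Z_def by blast
  then show "is_outer_inverse_with a P x \<longleftrightarrow> x \<in> Y \<inter> Z"
    unfolding is_outer_inverse_with_def Y_def Z_def by (auto simp: P)
  show "x \<in> Y \<inter> Z \<longleftrightarrow> is_mitsch_max Y x \<and> is_mitsch_min Z x"
    unfolding is_mitsch_max_def is_mitsch_min_def Y_def Z_def using le by auto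
qed

theorem theorem5p8:
  fixes a x :: "'a::ring_1" and S T S' T' :: "'a set"
  assumes "right_ideal S" and "right_ideal T" and "left_ideal S'" and "left_ideal T'"
  shows
    "((is_outer_inverse_rprin_lprin a S S' x \<longleftrightarrow>
        x \<in> Y_rprin_lprin a S S' \<inter> Z_rprin_lprin a S S') \<and>
      (x \<in> Y_rprin_lprin a S S' \<inter> Z_rprin_lprin a S S' \<longleftrightarrow>
        is_mitsch_max (Y_rprin_lprin a S S') x \<and> is_mitsch_min (Z_rprin_lprin a S S') x)) \<and>
     ((is_outer_inverse_rprin_rann a S T x \<longleftrightarrow>
        x \<in> Y_rprin_rann a S T \<inter> Z_rprin_rann a S T) \<and>
      (x \<in> Y_rprin_rann a S T \<inter> Z_rprin_rann a S T \<longleftrightarrow>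
        is_mitsch_max (Y_rprin_rann a S T) x \<and> is_mitsch_min (Z_rprin_rann a S T) x)) \<and>
     ((is_outer_inverse_lprin_lann a S' T' x \<longleftrightarrow>
        x \<in> Y_lprin_lann a S' T' \<inter> Z_lprin_lann a S' T') \<and>
      (x \<in> Y_lprin_lann a S' T' \<inter> Z_lprin_lann a S' T' \<longleftrightarrow>
        is_mitsch_max (Y_lprin_lann a S' T') x \<and> is_mitsch_min (Z_lprin_lann a S' T') x)) \<and>
     ((is_outer_inverse_rann_lann a T T' x \<longleftrightarrow>
        x \<in> Y_rann_lann a T T' \<inter> Z_rann_lann a T T') \<and>
      (x \<in> Y_rann_lann a T T' \<inter> Z_rann_lann a T T' \<longleftrightarrow>
        is_mitsch_max (Y_rann_lann a T T') x \<and> is_mitsch_min (Z_rann_lann a T T') x))"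
proof -
  have rprin_lprin: "(is_outer_inverse_rprin_lprin a S S' x \<longleftrightarrow>
        x \<in> Y_rprin_lprin a S S' \<inter> Z_rprin_lprin a S S') \<and>
      (x \<in> Y_rprin_lprin a S S' \<inter> Z_rprin_lprin a S S' \<longleftrightarrow>
        is_mitsch_max (Y_rprin_lprin a S S') x \<and> is_mitsch_min (Z_rprin_lprin a S S') x)"
    unfolding is_outer_inverse_rprin_lprin_def Y_rprin_lprin_def Z_rprin_lprin_def
  proof (rule outer_inverse_sandwich)
    fix z
    show "rprin z = S \<and> lprin z = S' \<longleftrightarrow> (z \<in> S \<inter> S') \<and> (S \<subseteq> rprin z \<and> S' \<subseteq> lprin z)"
      using rprin_subset_right_ideal_iff[OF assms(1)] lprin_subset_left_ideal_iff[OF assms(3)] by blast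
  next
    fix y z
    assume y: "y \<in> outer_inverses a" and z: "z \<in> outer_inverses a"
      and L: "y \<in> S \<inter> S'" and U: "S \<subseteq> rprin z \<and> S' \<subseteq> lprin z"
    show "mitsch_le y z"
    proof (rule mitsch_leI_outer[OF y])
      show "z * a * y = y"
        by (rule left_fixed_if_mem_rprin[OF z]) (use L U in blast)
      show "y * a * z = y"
        by (rule right_fixed_if_mem_lprin[OF z]) (use L U in blast)
    qed
  qed

  have rprin_rann: "(is_outer_inverse_rprin_rann a S T x \<longleftrightarrow>
        x \<in> Y_rprin_rann a S T \<inter> Z_rprin_rann a S T) \<and>
      (x \<in> Y_rprin_rann a S T \<inter> Z_rprin_rann a S T \<longleftrightarrow>
        is_mitsch_max (Y_rprin_rann a S T) x \<and> is_mitsch_min (Z_rprin_rann a S T) x)"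
    unfolding is_outer_inverse_rprin_rann_def Y_rprin_rann_def Z_rprin_rann_def
  proof (rule outer_inverse_sandwich)
    fix z
    show "rprin z = S \<and> rann z = T \<longleftrightarrow> (z \<in> S \<and> T \<subseteq> rann z) \<and> (S \<subseteq> rprin z \<and> rann z \<subseteq> T)"
      using rprin_subset_right_ideal_iff[OF assms(1)] by blast
  next
    fix y z
    assume y: "y \<in> outer_inverses a" and z: "z \<in> outer_inverses a"
      and L: "y \<in> S \<and> T \<subseteq> rann y" and U: "S \<subseteq> rprin z \<and> rann z \<subseteq> T"
    show "mitsch_le y z"
    proof (rule mitsch_leI_outer[OF y])
      show "z * a * y = y"
        by (rule left_fixed_if_mem_rprin[OF z]) (use L U in blast)
      show "y * a * z = y"
        by (rule right_fixed_if_rann_subset[OF z]) (use L U in blast)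
    qed
  qed

  have lprin_lann: "(is_outer_inverse_lprin_lann a S' T' x \<longleftrightarrow>
        x \<in> Y_lprin_lann a S' T' \<inter> Z_lprin_lann a S' T') \<and>
      (x \<in> Y_lprin_lann a S' T' \<inter> Z_lprin_lann a S' T' \<longleftrightarrow>
        is_mitsch_max (Y_lprin_lann a S' T') x \<and> is_mitsch_min (Z_lprin_lann a S' T') x)"
    unfolding is_outer_inverse_lprin_lann_def Y_lprin_lann_def Z_lprin_lann_def
  proof (rule outer_inverse_sandwich)
    fix z
    show "lprin z = S' \<and> lann z = T' \<longleftrightarrow> (z \<in> S' \<and> T' \<subseteq> lann z) \<and> (S' \<subseteq> lprin z \<and> lann z \<subseteq> T')"
      using lprin_subset_left_ideal_iff[OF assms(3)] by blast
  next
    fix y z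
    assume y: "y \<in> outer_inverses a" and z: "z \<in> outer_inverses a"
      and L: "y \<in> S' \<and> T' \<subseteq> lann y" and U: "S' \<subseteq> lprin z \<and> lann z \<subseteq> T'"
    show "mitsch_le y z"
    proof (rule mitsch_leI_outer[OF y])
      show "z * a * y = y"
        by (rule left_fixed_if_lann_subset[OF z]) (use L U in blast)
      show "y * a * z = y"
        by (rule right_fixed_if_mem_lprin[OF z]) (use L U in blast)
    qed
  qed

  have rann_lann: "(is_outer_inverse_rann_lann a T T' x \<longleftrightarrow>
        x \<in> Y_rann_lann a T T' \<inter> Z_rann_lann a T T') \<and>
      (x \<in> Y_rann_lann a T T' \<inter> Z_rann_lann a T T' \<longleftrightarrow>
        is_mitsch_max (Y_rann_lann a T T') x \<and> is_mitsch_min (Z_rann_lann a T T') x)"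
    unfolding is_outer_inverse_rann_lann_def Y_rann_lann_def Z_rann_lann_def
  proof (rule outer_inverse_sandwich)
    fix z
    show "rann z = T \<and> lann z = T' \<longleftrightarrow> (T \<subseteq> rann z \<and> T' \<subseteq> lann z) \<and> (rann z \<subseteq> T \<and> lann z \<subseteq> T')"
      by blast
  next
    fix y z
    assume y: "y \<in> outer_inverses a" and z: "z \<in> outer_inverses a"
      and L: "T \<subseteq> rann y \<and> T' \<subseteq> lann y" and U: "rann z \<subseteq> T \<and> lann z \<subseteq> T'"
    show "mitsch_le y z"
    proof (rule mitsch_leI_outer[OF y])
      show "z * a * y = y"
        by (rule left_fixed_if_lann_subset[OF z]) (use L U in blast)
      show "y * a * z = y"
        by (rule right_fixed_if_rann_subset[OF z]) (use L U in blast)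
    qed
  qed

  show ?thesis
    using rprin_lprin rprin_rann lprin_lann rann_lann by (rule conjI[OF _ conjI[OF _ conjI]])
qed

end
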